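(* Let $\mathcal{C}\subseteq\mathbb{S}^N$ be a nonempty spectrahedral cone and let $X\in\mathcal{C}$ be nonzero. Run the extreme ray decomposition algorithm (described in the context) on $(\mathcal{C},X)$, and suppose that at every iteration the problem defining $M_k$ and the problem defining $t_k$ can be solved exactly. Then every step of the algorithm is well defined, and the algorithm terminates after finitely many steps. Moreover, with probability $1$, its output $\{t_k,M_k\}_{k=1}^r$ is an extreme ray decomposition of $X$ in $\mathcal{C}$, i.e. $X=\sum_{k=1}^r t_kM_k$, where $t_k>0$ and $\mathbb{R}_+M_k$ is an extreme ray of $\mathcal{C}$ for every $k\in\{1,\dots,r\}$.
   Context: $\mathbb{S}^N$ is the space of real symmetric $N\times N$ matrices, $\mathbb{S}^N_+$ the cone of positive semidefinite matrices in $\mathbb{S}^N$, and $\langle A,B\rangle=\mathrm{tr}(AB)$. A spectrahedral cone in $\mathbb{S}^N$ is a set of the form $\mathcal{L}\cap\mathbb{S}^N_+$ with $\mathcal{L}\subseteq\mathbb{S}^N$ a linear subspace. For a convex set $C$ and $x\in C$, $\mathrm{minface}(x,C)$ is the minimal face of $C$ containing $x$. For $M\neq 0$, $\mathbb{R}_+M=\{tM: t\ge 0\}$; for $0\ne M\in\mathcal{C}$ it is an extreme ray of $\mathcal{C}$ if $M=Y+Z$ with $Y,Z\in\mathcal{C}$ implies $Y,Z\in\mathbb{R}_+M$. Extreme ray decomposition algorithm. Input: a nonempty spectrahedral cone $\mathcal{C}\subseteq\mathbb{S}^N$ and an initial point $0\neq X\in\mathcal{C}$. Set $k=1$, $X_1=X$.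 While $X_k\neq 0$: 1. Set $\mathcal{F}_k=\mathrm{minface}(X_k,\mathcal{C})$. 2. Let $B_k$ be a random matrix from any absolutely continuous distribution (with respect to Lebesgue measure) on $\mathbb{S}^N$. 3. Generate $M_k\in\mathbb{S}^N$ from the linear semidefinite program $M_k\in\arg\min\{\langle B_k,Y\rangle : Y\in\mathcal{F}_k,\ \mathrm{tr}(Y)=1\}$. 4. Find $t_k=\sup\{t\ge 0: X_k-tM_k\in\mathcal{F}_k\}$. 5. Set $X_{k+1}=X_k-t_kM_k$ and increase $k$ by one. When the loop ends, return $r=k-1$ and $\{t_k,M_k\}_{k=1}^r$. *)

theory Defs
  imports "HOL-Probability.Probability"
begin

text \<open>The size \<open>N\<close> of the matrices is \<^term>\<open>CARD('n)\<close> for \<^typ>\<open>real^'n^'n\<close>.\<close>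

definition sym_mats :: "(real^'n^'n) set" where
  "sym_mats = {A. transpose A = A}"

definition psd_cone :: "(real^'n^'n) set" where
  "psd_cone = {A \<in> sym_mats. \<forall>v. 0 \<le> v \<bullet> (A *v v)}"

definition spectrahedral_cone :: "(real^'n^'n) set \<Rightarrow> bool" where
  "spectrahedral_cone C \<longleftrightarrow> (\<exists>L. subspace L \<and> L \<subseteq> sym_mats \<and> C = L \<inter> psd_cone)"

definition minface :: "'a::real_vector \<Rightarrow> 'a set \<Rightarrow> 'a set" where
  "minface x C = \<Inter>{F. F face_of C \<and> x \<in> F}"

definition nonneg_ray :: "'a::real_vector \<Rightarrow> 'a set" where
  "nonneg_ray M = {t *\<^sub>R M | t. 0 \<le> t}"

text \<open>\<open>spans_extreme_ray M C\<close>: the ray \<open>nonneg_ray M\<close> is an extreme ray of the cone \<open>C\<close>.\<close>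

definition spans_extreme_ray :: "'a::real_vector \<Rightarrow> 'a set \<Rightarrow> bool" where
  "spans_extreme_ray M C \<longleftrightarrow> M \<noteq> 0 \<and> M \<in> C \<and>
     (\<forall>Y\<in>C. \<forall>Z\<in>C. M = Y + Z \<longrightarrow> Y \<in> nonneg_ray M \<and> Z \<in> nonneg_ray M)"

definition extreme_ray_decomposition ::
    "'a::real_vector set \<Rightarrow> 'a \<Rightarrow> nat \<Rightarrow> (nat \<Rightarrow> real) \<Rightarrow> (nat \<Rightarrow> 'a) \<Rightarrow> bool" where
  "extreme_ray_decomposition C X r t M \<longleftrightarrow>
     X = (\<Sum>k=1..r. t k *\<^sub>R M k) \<and> (\<forall>k\<in>{1..r}. 0 < t k \<and> spans_extreme_ray (M k) C)"

definition lp_solution :: "real^'n^'n \<Rightarrow> (real^'n^'n) set \<Rightarrow> real^'n^'n \<Rightarrow> bool" where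
  "lp_solution B F M \<longleftrightarrow> is_arg_min (\<lambda>Y. trace (B ** Y)) (\<lambda>Y. Y \<in> F \<and> trace Y = 1) M"

definition step_lengths :: "'a::real_vector set \<Rightarrow> 'a \<Rightarrow> 'a \<Rightarrow> real set" where
  "step_lengths F X M = {t. 0 \<le> t \<and> X - t *\<^sub>R M \<in> F}"

text \<open>
  \<open>erd_run C X b n Xs Ms ts\<close>: starting from \<open>X\<close> and using the objective matrices
  \<open>b 1, b 2, \<dots>\<close>, the loop body has been executed for \<open>k = 1, \<dots>, n\<close>, producing the
  iterates \<open>Xs 1, \<dots>, Xs (n + 1)\<close>. The algorithm has stopped, with output length \<open>n\<close>,
  iff moreover \<open>Xs (n + 1) = 0\<close>. Any minimizer may be chosen as \<open>Ms k\<close>; values of the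
  sequences at other indices are irrelevant.
\<close>

definition erd_run :: "(real^'n^'n) set \<Rightarrow> real^'n^'n \<Rightarrow> (nat \<Rightarrow> real^'n^'n) \<Rightarrow> nat \<Rightarrow>
    (nat \<Rightarrow> real^'n^'n) \<Rightarrow> (nat \<Rightarrow> real^'n^'n) \<Rightarrow> (nat \<Rightarrow> real) \<Rightarrow> bool" where
  "erd_run C X b n Xs Ms ts \<longleftrightarrow> Xs 1 = X \<and>
     (\<forall>k\<in>{1..n}. Xs k \<noteq> 0 \<and>
        lp_solution (b k) (minface (Xs k) C) (Ms k) \<and>
        ts k = Sup (step_lengths (minface (Xs k) C) (Xs k) (Ms k)) \<and>
        Xs (k + 1) = Xs k - ts k *\<^sub>R Ms k)"

text \<open>
  The loop body can be executed at the iterate \<open>X\<close> with objective \<open>B\<close>: the minimal face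
  is a face through \<open>X\<close>, the linear program attains its minimum, and for every minimizer
  the supremum defining the step length is a supremum of a nonempty set bounded above.
\<close>

definition erd_step_well_defined ::
    "(real^'n^'n) set \<Rightarrow> real^'n^'n \<Rightarrow> real^'n^'n \<Rightarrow> bool" where
  "erd_step_well_defined C B X \<longleftrightarrow>
     X \<in> C \<and> minface X C face_of C \<and> X \<in> minface X C \<and>
     (\<exists>M. lp_solution B (minface X C) M) \<and>
     (\<forall>M. lp_solution B (minface X C) M \<longrightarrow>
        step_lengths (minface X C) X M \<noteq> {} \<and> bdd_above (step_lengths (minface X C) X M))"

text \<open>
  Lebesgue measure on the space of symmetric matrices, as a Borel measure on all matrices
  concentrated on \<^const>\<open>sym_mats\<close>. The coordinates are the entries indexed by unordered
  pairs \<open>{i, j}\<close> (singletons for the diagonal). Lebesgue measure normalised by the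
  trace inner product differs by a positive constant only, so has the same null sets.
\<close>

definition sym_lborel :: "(real^'n^'n) measure" where
  "sym_lborel = distr (\<Pi>\<^sub>M s\<in>{{i, j} | i j. True}. lborel) borel (\<lambda>x. \<chi> i j. x {i, j})"

text \<open>\<open>D\<close> is a regular conditional distribution of \<open>Z\<close> given the sub-sigma-algebra \<open>G\<close>.\<close>

definition regular_cond_distr :: "'w measure \<Rightarrow> 'w measure \<Rightarrow> ('w \<Rightarrow> 'a::topological_space) \<Rightarrow>
    ('w \<Rightarrow> 'a measure) \<Rightarrow> bool" where
  "regular_cond_distr P G Z D \<longleftrightarrow> D \<in> measurable G (prob_algebra borel) \<and>
     (\<forall>A\<in>sets G. \<forall>S\<in>sets borel.
        emeasure P (A \<inter> Z -` S) = (\<integral>\<^sup>+\<omega>\<in>A. emeasure (D \<omega>) S \<partial>P))"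

text \<open>
  \<open>B k\<close> is the random matrix drawn in iteration \<open>k\<close>, and \<open>G k\<close> is the information available
  just before that draw. The distribution of \<open>B k\<close> may be chosen depending on that information,
  but must be absolutely continuous. A \<open>D\<close> that is constant in \<open>\<omega>\<close> gives the case in which
  \<open>B k\<close> has a fixed distribution and is independent of \<open>G k\<close>.
\<close>

definition random_objectives :: "'w measure \<Rightarrow> (nat \<Rightarrow> 'w measure) \<Rightarrow>
    (nat \<Rightarrow> 'w \<Rightarrow> real^'n^'n) \<Rightarrow> bool" where
  "random_objectives P G B \<longleftrightarrow> prob_space P \<and> filtration (space P) G \<and>
     (\<forall>k\<ge>1. subalgebra P (G k) \<and>
        (\<forall>\<omega>\<in>space P. B k \<omega> \<in> sym_mats) \<and> B k \<in> borel_measurable (G (k + 1)) \<and>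
        (\<exists>D. regular_cond_distr P (G k) (B k) D \<and>
             (\<forall>\<omega>\<in>space P. absolutely_continuous sym_lborel (D \<omega>))))"

end

theory Submission
  imports Defs
begin

text \<open>
  In a closed convex cone \<open>C\<close> with compact base, the minimal face of \<open>X\<close> consists of the
  \<open>Y \<in> C\<close> with \<open>X - e Y \<in> C\<close> for some \<open>e > 0\<close>. Maximality of the step length puts \<open>M\<^sub>k\<close> outside
  the minimal face of the next iterate, so the dimension of the face drops strictly.

  A unique minimizer over the base of a face spans an extreme ray. If a minimizer is not
  unique, a symmetric coordinate direction \<open>E\<close> and rationals \<open>p < q\<close> exist such that minimizers
  \<open>Y\<close>, \<open>Y'\<close> satisfy \<open>E \<bullet> Y \<le> p\<close> and \<open>q \<le> E \<bullet> Y'\<close>; by monotonicity of minimizers this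
  happens for at most one objective on every line parallel to \<open>E\<close>, hence by Fubini on a null set.
  That null set depends on the current iterate, which is random: the minimal face is a
  countable union of compact sets depending semicontinuously on \<open>X\<close>, which makes the set of bad pairs
  Borel and the iterates adapted, so the regular conditional distributions can be used.
\<close>

section \<open>Minimal faces and steps in cones with compact base\<close>

lemma face_of_minface:
  assumes "convex C" "X \<in> C"
  shows "minface X C face_of C" "X \<in> minface X C"
proof -
  show "minface X C face_of C"
    unfolding minface_def using face_of_refl[OF assms(1)] assms(2) by (intro face_of_Inter) auto
  show "X \<in> minface X C" by (simp add: minface_def)
qed

lemma minface_subset: "F face_of C \<Longrightarrow> X \<in> F \<Longrightarrow> minface X C \<subseteq> F"
  by (auto simp: minface_def)

lemma convex_cone_diff_scaleR_mono:
  assumes "convex_cone C" "Y \<in> C" "X - e *\<^sub>R Y \<in> C" "d \<le> e"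
  shows "X - d *\<^sub>R Y \<in> C"
proof -
  have "X - d *\<^sub>R Y = (X - e *\<^sub>R Y) + (e - d) *\<^sub>R Y" by (simp add: algebra_simps)
  also have "\<dots> \<in> C" using assms by (intro convex_cone_add convex_cone_scaleR) auto
  finally show ?thesis .
qed

text \<open>The right-hand set is itself a face through X, which gives one inclusion. Conversely, X
  is the midpoint of \<open>2 e Y\<close> and \<open>2 (X - e Y)\<close>, so every face through X
  contains \<open>2 e Y\<close> and, being conic, Y.\<close>

lemma minface_convex_cone:
  assumes C: "convex_cone C" and X: "X \<in> C"
  shows "minface X C = {Y \<in> C. \<exists>e>0. X - e *\<^sub>R Y \<in> C}" (is "_ = ?G")
proof
  note add = convex_cone_add[OF C] and scale = convex_cone_scaleR[OF C]
  have conv: "convex C" and con: "conic C" using C by (auto simp: convex_cone_def)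
  show "minface X C \<subseteq> ?G"
  proof (rule minface_subset)
    show "X \<in> ?G" using X convex_cone_contains_0[OF C] by (auto intro!: exI[of _ 1])
    show "?G face_of C"
      unfolding face_of_def
    proof (intro conjI ballI impI)
      show "convex ?G"
      proof (rule convexI)
        fix Y Z and u v :: real
        assume Y: "Y \<in> ?G" and Z: "Z \<in> ?G" and uv: "0 \<le> u" "0 \<le> v" "u + v = 1"
        obtain d e where d: "d > 0" "X - d *\<^sub>R Y \<in> C" and e: "e > 0" "X - e *\<^sub>R Z \<in> C"
          using Y Z by auto
        \<comment> \<open>Smaller multiples of Y and Z can be removed from X as well, so the minimum
          serves both points.\<close>
        define m where "m = min d e"
        have m: "m > 0" "m \<le> d" "m \<le> e" using d e by (auto simp: m_def)
        have "X - m *\<^sub>R Y \<in> C" "X - m *\<^sub>R Z \<in> C"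
          using convex_cone_diff_scaleR_mono[OF C _ d(2)] convex_cone_diff_scaleR_mono[OF C _ e(2)] Y Z m
          by simp_all
        hence "u *\<^sub>R (X - m *\<^sub>R Y) + v *\<^sub>R (X - m *\<^sub>R Z) \<in> C"
          using uv by (intro add scale) auto
        also have "u *\<^sub>R (X - m *\<^sub>R Y) + v *\<^sub>R (X - m *\<^sub>R Z) = (u + v) *\<^sub>R X - m *\<^sub>R (u *\<^sub>R Y + v *\<^sub>R Z)"
          by (simp add: algebra_simps)
        finally show "u *\<^sub>R Y + v *\<^sub>R Z \<in> ?G"
          using Y Z uv m by (auto simp: add scale intro!: exI[of _ m])
      qed
    next
      \<comment> \<open>One endpoint is enough because open segments are symmetric. Removing only
        the a-part of \<open>e x\<close> leaves the remainder \<open>X - e x\<close> plus a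
        nonnegative multiple of b.\<close>
      have half: "a \<in> ?G" if ab: "a \<in> C" "b \<in> C" "x \<in> ?G" "x \<in> open_segment a b" for a b x
      proof -
        obtain e where e: "e > 0" "X - e *\<^sub>R x \<in> C" using ab by auto
        obtain u where u: "0 < u" "u < 1" "x = (1 - u) *\<^sub>R a + u *\<^sub>R b"
          using ab by (auto simp: in_segment)
        have "X - (e * (1 - u)) *\<^sub>R a = (X - e *\<^sub>R x) + (e * u) *\<^sub>R b"
          unfolding u(3) by (simp add: algebra_simps)
        also have "\<dots> \<in> C" using e u ab add scale by simp
        finally show ?thesis using ab e u by (auto intro!: exI[of _ "e * (1 - u)"])
      qed
      fix a b x
      assume ab: "a \<in> C" "b \<in> C" "x \<in> ?G" "x \<in> open_segment a b"
      show "a \<in> ?G" using half[OF ab] .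
      show "b \<in> ?G" using half[of b a x] ab by (simp add: open_segment_commute)
    qed auto
  qed
  show "?G \<subseteq> minface X C"
  proof
    fix Y assume "Y \<in> ?G"
    then obtain e where Y: "Y \<in> C" and e: "e > 0" "X - e *\<^sub>R Y \<in> C" by auto
    have face: "minface X C face_of C" and XF: "X \<in> minface X C"
      using face_of_minface[OF conv X] by auto
    define a b where "a = (2 * e) *\<^sub>R Y" and "b = 2 *\<^sub>R (X - e *\<^sub>R Y)"
    have ab: "a \<in> C" "b \<in> C" using Y e scale by (auto simp: a_def b_def)
    have mid: "X = (1 - 1 / 2) *\<^sub>R a + (1 / 2 :: real) *\<^sub>R b"
      by (simp add: a_def b_def algebra_simps)
    have "a \<in> minface X C"
    \<comment> \<open>The face property speaks of nondegenerate segments only; if the endpoints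
      coincide, both equal X.\<close>
    proof (cases "a = b")
      case True
      hence "X = a" using mid by (metis scaleR_collapse)
      thus ?thesis using XF by simp
    next
      case False
      hence "X \<in> open_segment a b" using mid by (auto simp: in_segment intro!: exI[of _ "1/2"])
      thus ?thesis using face ab XF by (auto simp: face_of_def)
    qed
    hence "(1 / (2 * e)) *\<^sub>R a \<in> minface X C"
      using face_of_conic[OF con face] e by (simp add: conic_def)
    thus "Y \<in> minface X C" using e by (simp add: a_def)
  qed
qed

lemma borel_measurable_fst_snd:
  "(fst :: 'a::second_countable_topology \<times> 'b::second_countable_topology \<Rightarrow> 'a) \<in> borel_measurable borel"
  "(snd :: 'a \<times> 'b \<Rightarrow> 'b) \<in> borel_measurable borel"
  by (auto intro!: borel_measurable_continuous_onI continuous_intros)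

text \<open>Abstract form of \<open>lp_solution\<close>: on symmetric matrices the trace pairing is
  the entrywise inner product.\<close>

definition lin_min :: "'a::real_inner \<Rightarrow> 'a set \<Rightarrow> 'a \<Rightarrow> bool" where
  "lin_min B K Y \<longleftrightarrow> Y \<in> K \<and> (\<forall>Z\<in>K. B \<bullet> Y \<le> B \<bullet> Z)"

text \<open>Here \<open>\<tau>\<close> stands for the trace. The norm bound makes the part of C with
  \<open>\<tau> = 1\<close> compact and \<open>\<tau>\<close> positive on C away from 0.\<close>

locale based_cone =
  fixes C :: "'a::euclidean_space set" and \<tau> :: "'a \<Rightarrow> real" and \<kappa> :: real
  assumes cone: "convex_cone C" and closed_C: "closed C" and linear_\<tau>: "linear \<tau>"
    and bound: "\<And>x. x \<in> C \<Longrightarrow> norm x \<le> \<kappa> * \<tau> x" and \<kappa>_pos: "\<kappa> > 0"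
begin

lemmas add_in = convex_cone_add[OF cone] and scale_in = convex_cone_scaleR[OF cone]

lemma convex_C: "convex C"
  using cone by (simp add: convex_cone_def)

lemma zero_in: "0 \<in> C" by (rule convex_cone_contains_0[OF cone])

lemmas minface_eq = minface_convex_cone[OF cone]

lemma \<tau>_simps:
  "\<tau> (x + y) = \<tau> x + \<tau> y" "\<tau> (x - y) = \<tau> x - \<tau> y" "\<tau> (c *\<^sub>R x) = c * \<tau> x"
  using linear_add[OF linear_\<tau>] linear_diff[OF linear_\<tau>] linear_scale[OF linear_\<tau>] by auto

lemma continuous_on_\<tau>[continuous_intros]: "continuous_on S f \<Longrightarrow> continuous_on S (\<lambda>x. \<tau> (f x))"
  by (rule bounded_linear.continuous_on[OF linear_conv_bounded_linear[THEN iffD1, OF linear_\<tau>]])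

lemma \<tau>_nonneg: "x \<in> C \<Longrightarrow> 0 \<le> \<tau> x"
  using bound[of x] \<kappa>_pos norm_ge_zero[of x] by (smt (verit) mult_pos_neg)

lemma \<tau>_pos: "x \<in> C \<Longrightarrow> x \<noteq> 0 \<Longrightarrow> 0 < \<tau> x"
  using bound[of x] \<kappa>_pos by (smt (verit) mult_nonneg_nonpos zero_less_norm_iff)

section \<open>The base of the cone and the feasible set of the linear program\<close>

definition base :: "'a set" where "base = {Y \<in> C. \<tau> Y = 1}"

lemma compact_base: "compact base"
proof -
  have "closed base"
    unfolding base_def Collect_conj_eq
    using closed_C by (auto intro!: closed_Int closed_Collect_eq continuous_intros)
  moreover have "bounded base"
    unfolding bounded_iff using bound by (force simp: base_def)
  ultimately show ?thesis by (simp add: compact_eq_bounded_closed)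
qed

text \<open>The feasible set of the linear program at X, written through the description of the
  minimal face. In this form it makes sense for every X and is empty when X is 0 or outside
  C.\<close>

definition slice :: "'a \<Rightarrow> 'a set" where
  "slice X = {Y \<in> base. \<exists>e>0. X - e *\<^sub>R Y \<in> C}"

lemma slice_eq: "X \<in> C \<Longrightarrow> slice X = {Y \<in> minface X C. \<tau> Y = 1}"
  by (auto simp: slice_def base_def minface_eq)

lemma slice_subset_base: "slice X \<subseteq> base" by (auto simp: slice_def)

lemma slice_nonempty_iff: "slice X \<noteq> {} \<longleftrightarrow> X \<in> C \<and> X \<noteq> 0"
proof
  assume "slice X \<noteq> {}"
  then obtain Y e where Y: "Y \<in> C" "\<tau> Y = 1" "e > 0" "X - e *\<^sub>R Y \<in> C"
    by (auto simp: slice_def base_def)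
  hence "(X - e *\<^sub>R Y) + e *\<^sub>R Y \<in> C" by (intro add_in scale_in) auto
  hence "X \<in> C" by simp
  moreover have "\<tau> X \<ge> e" using \<tau>_nonneg[OF Y(4)] Y by (simp add: \<tau>_simps)
  ultimately show "X \<in> C \<and> X \<noteq> 0" using Y linear_0[OF linear_\<tau>] by auto
next
  assume X: "X \<in> C \<and> X \<noteq> 0"
  hence t: "\<tau> X > 0" using \<tau>_pos by simp
  \<comment> \<open>X scaled to the base; removing \<open>\<tau> X\<close> times this point leaves
    0.\<close>
  have "(1 / \<tau> X) *\<^sub>R X \<in> slice X"
    using X t zero_in by (auto simp: slice_def base_def \<tau>_simps intro!: scale_in exI[of _ "\<tau> X"])
  thus "slice X \<noteq> {}" by auto
qed

lemma closed_minface: "X \<in> C \<Longrightarrow> closed (minface X C)"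
  using face_of_imp_closed[OF convex_C closed_C face_of_minface(1)[OF convex_C]] .

lemma compact_slice: "X \<in> C \<Longrightarrow> compact (slice X)"
proof -
  assume X: "X \<in> C"
  have "slice X = base \<inter> minface X C"
    using X by (auto simp: slice_eq base_def minface_eq)
  thus ?thesis using compact_base closed_minface[OF X] by auto
qed

lemma ex_lin_min: "X \<in> C \<Longrightarrow> X \<noteq> 0 \<Longrightarrow> \<exists>M. lin_min B (slice X) M"
  using continuous_attains_inf[OF compact_slice, of X "\<lambda>Y. B \<bullet> Y"] slice_nonempty_iff[of X]
    continuous_on_inner[OF continuous_on_const continuous_on_id, of "slice X" B]
  unfolding lin_min_def by blast

section \<open>Step lengths and the drop in dimension\<close>

lemma minface_step:
  assumes X: "X \<in> C" and M: "M \<in> minface X C" and t: "0 \<le> t"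
  shows "X - t *\<^sub>R M \<in> minface X C \<longleftrightarrow> X - t *\<^sub>R M \<in> C"
proof -
  \<comment> \<open>The complement of the remainder in X is \<open>t M\<close>, so the factor 1
    witnesses that a remainder in C already lies in the minimal face.\<close>
  have "X - 1 *\<^sub>R (X - t *\<^sub>R M) \<in> C" using M t X by (auto simp: minface_eq intro!: scale_in)
  thus ?thesis using X by (auto simp: minface_eq intro!: exI[of _ 1])
qed

lemma step_lengths_minface:
  assumes "X \<in> C" "M \<in> minface X C"
  shows "step_lengths (minface X C) X M = step_lengths C X M"
  using minface_step[OF assms] by (auto simp: step_lengths_def)

text \<open>Along the direction -M the functional \<open>\<tau>\<close> falls at unit rate, and on C
  it cannot become negative.\<close>

lemma step_lengths_bounds:
  assumes X: "X \<in> C" and M: "\<tau> M = 1"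
  shows "0 \<in> step_lengths C X M" "step_lengths C X M \<subseteq> {0..\<tau> X}"
  using X \<tau>_nonneg M by (auto simp: step_lengths_def \<tau>_simps dest!: \<tau>_nonneg)

lemma bdd_above_step_lengths:
  assumes "X \<in> C" "\<tau> M = 1"
  shows "bdd_above (step_lengths C X M)"
  using step_lengths_bounds(2)[OF assms] by (meson bdd_above_Icc bdd_above_mono)

lemma closed_step_lengths: "closed (step_lengths C X M)"
proof -
  have "closed ({0..} \<inter> (\<lambda>t. X - t *\<^sub>R M) -` C)"
    by (intro closed_Int closed_atLeast closed_vimage closed_C continuous_intros)
  also have "{0..} \<inter> (\<lambda>t. X - t *\<^sub>R M) -` C = step_lengths C X M"
    by (auto simp: step_lengths_def)
  finally show ?thesis .
qed

definition max_step :: "'a \<Rightarrow> 'a \<Rightarrow> real" where "max_step X M = Sup (step_lengths C X M)"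

lemma max_step_in:
  assumes "X \<in> C" "\<tau> M = 1"
  shows "max_step X M \<in> step_lengths C X M"
  unfolding max_step_def using step_lengths_bounds[OF assms] bdd_above_step_lengths[OF assms]
  by (intro closed_contains_Sup closed_step_lengths) auto

lemma max_step_ge: "X \<in> C \<Longrightarrow> \<tau> M = 1 \<Longrightarrow> t \<in> step_lengths C X M \<Longrightarrow> t \<le> max_step X M"
  unfolding max_step_def by (intro cSup_upper bdd_above_step_lengths)

lemma max_step_pos:
  assumes X: "X \<in> C" and M: "M \<in> slice X"
  shows "0 < max_step X M"
proof -
  obtain e where "e > 0" "X - e *\<^sub>R M \<in> C" using M by (auto simp: slice_def)
  hence "e \<in> step_lengths C X M" by (simp add: step_lengths_def)
  with max_step_ge[OF X _ this] M \<open>e > 0\<close> show ?thesis by (auto simp: slice_def base_def)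
qed

lemma next_in:
  assumes "X \<in> C" "M \<in> slice X"
  shows "X - max_step X M *\<^sub>R M \<in> minface X C"
  using assms max_step_in[of X M] minface_step[of X M "max_step X M"]
  by (auto simp: slice_eq step_lengths_def)

lemma next_in_C:
  assumes "X \<in> C" "M \<in> slice X"
  shows "X - max_step X M *\<^sub>R M \<in> C"
  using next_in[OF assms] assms(1) by (simp add: minface_eq)

text \<open>The new minimal face lies in the old one because the new iterate does. It is a proper
  face: if it contained M, a further multiple of M could be removed, contradicting maximality of the
  step.\<close>

lemma aff_dim_next:
  assumes X: "X \<in> C" and M: "M \<in> slice X"
  shows "aff_dim (minface (X - max_step X M *\<^sub>R M) C) < aff_dim (minface X C)"
proof -
  define X' where "X' = X - max_step X M *\<^sub>R M"
  have X': "X' \<in> C" "X' \<in> minface X C" using next_in[OF X M] next_in_C[OF X M] by (auto simp: X'_def)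
  have face: "minface X C face_of C" by (rule face_of_minface[OF convex_C X])
  have face': "minface X' C face_of C" by (rule face_of_minface[OF convex_C X'(1)])
  have sub: "minface X' C \<subseteq> minface X C" by (rule minface_subset[OF face X'(2)])
  have M': "M \<in> minface X C" "\<tau> M = 1" "M \<in> C" using M X by (auto simp: slice_eq minface_eq)
  have "M \<notin> minface X' C"
  proof
    assume "M \<in> minface X' C"
    then obtain e where e: "e > 0" "X' - e *\<^sub>R M \<in> C" using X' by (auto simp: minface_eq)
    have "max_step X M + e \<in> step_lengths C X M"
      using e max_step_pos[OF X M] by (simp add: step_lengths_def X'_def algebra_simps)
    from max_step_ge[OF X M'(2) this] e show False by simp
  qed
  hence "minface X' C \<noteq> minface X C" using M' by blast
  moreover have "minface X' C face_of minface X C"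
    using face_of_subset[OF face' sub] face_of_imp_subset[OF face] by simp
  moreover have "convex (minface X C)" using face by (rule face_of_imp_convex)
  ultimately show ?thesis unfolding X'_def[symmetric] by (intro face_of_aff_dim_lt)
qed

text \<open>If M = Y + Z with both summands nonzero, then Y and Z scaled to the base lie in the
  slice, and M is their convex combination with weights \<open>\<tau> Y\<close> and
  \<open>\<tau> Z\<close>. Scaled Y cannot beat M, so scaled Z is at least as good as M; it is a
  minimizer and hence equals M.\<close>

lemma unique_lin_min_extreme_ray:
  assumes X: "X \<in> C" and M: "lin_min B (slice X) M"
    and uniq: "\<And>M'. lin_min B (slice X) M' \<Longrightarrow> M' = M"
  shows "spans_extreme_ray M C"
proof -
  have MS: "M \<in> slice X" using M by (simp add: lin_min_def)
  hence M': "M \<in> C" "\<tau> M = 1" "M \<in> minface X C" by (auto simp: slice_eq X minface_eq)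
  obtain e where e: "e > 0" "X - e *\<^sub>R M \<in> C" using MS by (auto simp: slice_def)
  \<comment> \<open>Stated for the second summand only; exchanging the summands gives the other one.
    A zero summand cannot be scaled to the base and is treated apart.\<close>
  have part: "Z = \<tau> Z *\<^sub>R M" if YZ: "Y \<in> C" "Z \<in> C" "M = Y + Z" for Y Z
  proof (cases "Y = 0 \<or> Z = 0")
    case True
    hence "Z = 0 \<or> Z = M" using YZ by auto
    thus ?thesis using M'(2) linear_0[OF linear_\<tau>] by auto
  next
    case False
    hence pos: "0 < \<tau> Y" "0 < \<tau> Z" using YZ \<tau>_pos by auto
    have sum: "\<tau> Y + \<tau> Z = 1" using M' YZ by (simp add: \<tau>_simps)
    have sl: "(1 / \<tau> V) *\<^sub>R V \<in> slice X" if V: "V \<in> C" "W \<in> C" "M = V + W" "0 < \<tau> V" for V W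
    proof -
      have "X - e *\<^sub>R V = (X - e *\<^sub>R M) + e *\<^sub>R W" using V by (simp add: algebra_simps)
      also have "\<dots> \<in> C" using e V by (intro add_in scale_in) auto
      finally have "X - e *\<^sub>R V \<in> C" .
      thus ?thesis using V e by (auto simp: slice_def base_def \<tau>_simps scale_in intro!: exI[of _ "e * \<tau> V"])
    qed
    have sY: "(1 / \<tau> Y) *\<^sub>R Y \<in> slice X" using sl[of Y Z] YZ pos by simp
    have sZ: "(1 / \<tau> Z) *\<^sub>R Z \<in> slice X" using sl[of Z Y] YZ pos by (simp add: add.commute)
    have "B \<bullet> M \<le> B \<bullet> ((1 / \<tau> Y) *\<^sub>R Y)" using M sY unfolding lin_min_def by blast
    hence "\<tau> Y * (B \<bullet> M) \<le> B \<bullet> Y" using pos by (simp add: field_simps)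
    moreover have "B \<bullet> M = B \<bullet> Y + B \<bullet> Z" using YZ by (simp add: inner_add_right)
    moreover have "B \<bullet> M = \<tau> Y * (B \<bullet> M) + \<tau> Z * (B \<bullet> M)" using sum by (metis distrib_right mult_1)
    ultimately have "B \<bullet> Z \<le> \<tau> Z * (B \<bullet> M)" by linarith
    hence "B \<bullet> ((1 / \<tau> Z) *\<^sub>R Z) \<le> B \<bullet> M" using pos by (simp add: field_simps)
    hence "lin_min B (slice X) ((1 / \<tau> Z) *\<^sub>R Z)"
      using M sZ unfolding lin_min_def by (meson order_trans)
    from uniq[OF this] have "M = (1 / \<tau> Z) *\<^sub>R Z" by simp
    thus ?thesis using pos by simp
  qed
  show ?thesis
    unfolding spans_extreme_ray_def nonneg_ray_def
  proof (intro conjI ballI impI)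
    show "M \<noteq> 0" using M' linear_0[OF linear_\<tau>] by auto
    show "M \<in> C" by (rule M')
    fix Y Z assume YZ: "Y \<in> C" "Z \<in> C" "M = Y + Z"
    show "Z \<in> {t *\<^sub>R M |t. 0 \<le> t}" using part[OF YZ] \<tau>_nonneg[OF YZ(2)] by blast
    show "Y \<in> {t *\<^sub>R M |t. 0 \<le> t}"
      using part[of Z Y] YZ \<tau>_nonneg[OF YZ(1)] by (smt (verit) add.commute mem_Collect_eq)
  qed
qed

subsection \<open>Measurability of minimizers\<close>

text \<open>Smaller multiples of Y can be removed too, so a sequence of factors tending to 0
  suffices. The slice becomes a countable union of compact sets, and later existential conditions
  become countable unions.\<close>

lemma slice_iff: "Y \<in> slice X \<longleftrightarrow> Y \<in> base \<and> (\<exists>n. X - (1 / Suc n) *\<^sub>R Y \<in> C)"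
proof (intro iffI conjI)
  assume Y: "Y \<in> slice X"
  thus "Y \<in> base" by (simp add: slice_def)
  from Y obtain e where e: "e > 0" "X - e *\<^sub>R Y \<in> C" "Y \<in> C" by (auto simp: slice_def base_def)
  then obtain n :: nat where "inverse (Suc n) < e" using reals_Archimedean by blast
  thus "\<exists>n. X - (1 / Suc n) *\<^sub>R Y \<in> C"
    using convex_cone_diff_scaleR_mono[OF cone e(3,2), of "1 / Suc n"]
    by (intro exI[of _ n]) (simp add: inverse_eq_divide)
next
  assume *: "Y \<in> base \<and> (\<exists>n. X - (1 / Suc n) *\<^sub>R Y \<in> C)"
  then obtain n :: nat where "X - (1 / Suc n) *\<^sub>R Y \<in> C" by blast
  thus "Y \<in> slice X" using * unfolding slice_def by (intro CollectI conjI exI[of _ "1 / Suc n"]) auto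
qed

definition sublevel :: "'a set \<Rightarrow> real \<Rightarrow> ('a \<times> 'a \<times> real) set" where
  "sublevel K e = {(X, B, c). \<exists>Y. Y \<in> base \<inter> K \<and> X - e *\<^sub>R Y \<in> C \<and> B \<bullet> Y \<le> c}"

text \<open>This set is the projection of a closed set along the compact factor
  \<open>base \<inter> K\<close>, and such projections are closed.\<close>

lemma closed_sublevel:
  assumes "closed K"
  shows "closed (sublevel K e)"
proof -
  define T where "T = {w :: 'a \<times> 'a \<times> 'a \<times> real. fst (snd w) - e *\<^sub>R fst w \<in> C} \<inter>
    {w. fst (snd (snd w)) \<bullet> fst w \<le> snd (snd (snd w))}"
  have "closed ((\<lambda>w :: 'a \<times> 'a \<times> 'a \<times> real. fst (snd w) - e *\<^sub>R fst w) -` C)"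
    by (intro closed_vimage closed_C continuous_intros)
  hence "closed T"
    unfolding T_def by (intro closed_Int closed_Collect_le continuous_intros) (simp add: vimage_def)
  moreover have "compact (base \<inter> K)" using compact_base assms by (rule compact_Int_closed)
  ultimately have "closed {y. \<exists>x. x \<in> base \<inter> K \<and> (x, y) \<in> T}"
    by (rule closed_compact_projection[rotated])
  also have "{y. \<exists>x. x \<in> base \<inter> K \<and> (x, y) \<in> T} = sublevel K e"
    unfolding sublevel_def T_def by (auto split: prod.splits)
  finally show ?thesis .
qed

text \<open>The optimal value of the program, with 0 as a default where there is no feasible
  point.\<close>

definition opt :: "'a \<times> 'a \<Rightarrow> real" where
  "opt z = (if slice (fst z) = {} then 0 else INF Y\<in>slice (fst z). snd z \<bullet> Y)"

lemma bdd_below_slice: "bdd_below ((\<lambda>Y. B \<bullet> Y) ` slice X)"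
proof -
  have "bounded ((\<lambda>Y. B \<bullet> Y) ` base)"
    by (intro compact_imp_bounded compact_continuous_image compact_base continuous_intros)
  thus ?thesis
    by (rule bdd_below_mono[OF bounded_imp_bdd_below]) (use slice_subset_base in blast)
qed

text \<open>This replaces the comparison with all feasible points by a single level inequality, to
  which \<open>sublevel\<close> applies.\<close>

lemma lin_min_iff_opt:
  "lin_min B (slice X) Y \<longleftrightarrow> Y \<in> slice X \<and> B \<bullet> Y \<le> opt (X, B)"
proof
  assume "lin_min B (slice X) Y"
  thus "Y \<in> slice X \<and> B \<bullet> Y \<le> opt (X, B)"
    by (auto simp: lin_min_def opt_def intro!: cINF_greatest)
next
  assume Y: "Y \<in> slice X \<and> B \<bullet> Y \<le> opt (X, B)"
  have "opt (X, B) \<le> B \<bullet> Z" if "Z \<in> slice X" for Z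
    using cINF_lower[OF bdd_below_slice that] that by (auto simp: opt_def)
  thus "lin_min B (slice X) Y" using Y by (force simp: lin_min_def)
qed

lemma slice_nonempty_borel: "{z :: 'a \<times> 'a. slice (fst z) \<noteq> {}} \<in> sets borel"
proof -
  have "C - {0} \<in> sets borel" using closed_C by auto
  hence "(fst :: 'a \<times> 'a \<Rightarrow> 'a) -` (C - {0}) \<inter> space borel \<in> sets borel"
    by (rule measurable_sets[OF borel_measurable_fst_snd(1)])
  also have "(fst :: 'a \<times> 'a \<Rightarrow> 'a) -` (C - {0}) \<inter> space borel = {z. slice (fst z) \<noteq> {}}"
    by (auto simp: slice_nonempty_iff)
  finally show ?thesis .
qed

lemma opt_borel: "opt \<in> borel_measurable borel"
proof (rule borel_measurableI_less)
  fix a :: real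
  \<comment> \<open>A value below a is attained below some rational q < a and in some compact piece
    n of the slice. Pairs with empty slice have the default value 0, so they count exactly when 0 <
    a.\<close>
  have "{z \<in> space borel. opt z < a} =
     (if 0 < a then - {z. slice (fst z) \<noteq> {}} else {}) \<union>
     (\<Union>n::nat. \<Union>q\<in>{q \<in> \<rat>. q < a}. (\<lambda>z. (fst z, snd z, q)) -` sublevel UNIV (1 / Suc n))"
    (is "?L = ?R")
  proof (intro set_eqI iffI)
    fix z assume "z \<in> ?L"
    hence z: "opt z < a" by simp
    show "z \<in> ?R"
    proof (cases "slice (fst z) = {}")
      case True
      with z show ?thesis by (simp add: opt_def)
    next
      case False
      then obtain Y where Y: "Y \<in> slice (fst z)" "snd z \<bullet> Y < a"
        using z cINF_less_iff[OF False bdd_below_slice] by (auto simp: opt_def)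
      obtain n :: nat where n: "fst z - (1 / Suc n) *\<^sub>R Y \<in> C" and "Y \<in> base"
        using Y by (auto simp: slice_iff)
      obtain q where "q \<in> \<rat>" "snd z \<bullet> Y < q" "q < a" using Rats_dense_in_real[OF Y(2)] by auto
      with n \<open>Y \<in> base\<close>
      have "q \<in> {q \<in> \<rat>. q < a}" "z \<in> (\<lambda>z. (fst z, snd z, q)) -` sublevel UNIV (1 / Suc n)"
        by (auto simp: sublevel_def intro!: exI[of _ Y])
      thus ?thesis by blast
    qed
  next
    fix z assume z: "z \<in> ?R"
    show "z \<in> ?L"
    proof (cases "slice (fst z) = {}")
      case True
      have False if "z \<in> (\<lambda>z. (fst z, snd z, q)) -` sublevel UNIV (1 / Suc n)" for q and n :: nat
      proof -
        obtain Y where "Y \<in> base" "fst z - (1 / Suc n) *\<^sub>R Y \<in> C"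
          using \<open>z \<in> (\<lambda>z. (fst z, snd z, q)) -` sublevel UNIV (1 / Suc n)\<close> by (auto simp: sublevel_def)
        hence "Y \<in> slice (fst z)" unfolding slice_iff by blast
        with True show False by simp
      qed
      with z True show ?thesis by (auto simp: opt_def split: if_splits)
    next
      case False
      with z obtain q and n :: nat where q: "q < a"
        and "z \<in> (\<lambda>z. (fst z, snd z, q)) -` sublevel UNIV (1 / Suc n)"
        by (auto split: if_splits)
      then obtain Y where Y: "Y \<in> base" "fst z - (1 / Suc n) *\<^sub>R Y \<in> C" "snd z \<bullet> Y \<le> q"
        by (auto simp: sublevel_def)
      hence "Y \<in> slice (fst z)" unfolding slice_iff by blast
      thus ?thesis
        using Y q False cINF_lower[OF bdd_below_slice, of Y "fst z" "snd z"] by (simp add: opt_def)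
    qed
  qed
  moreover have "countable {q \<in> \<rat>. q < a}" using countable_rat by (rule countable_subset[rotated]) auto
  hence "(\<Union>n::nat. \<Union>q\<in>{q \<in> \<rat>. q < a}. (\<lambda>z. (fst z, snd z, q)) -` sublevel UNIV (1 / Suc n)) \<in> sets borel"
    by (intro sets.countable_UN' countableI_type image_subsetI borel_closed closed_vimage
        closed_sublevel continuous_intros closed_UNIV)
  moreover have "- {z :: 'a \<times> 'a. slice (fst z) \<noteq> {}} \<in> sets borel"
    using slice_nonempty_borel by (rule borel_comp)
  ultimately show "{z \<in> space borel. opt z < a} \<in> sets borel" by simp
qed

definition meets :: "'a set \<Rightarrow> ('a \<times> 'a) set" where
  "meets K = {z. \<exists>Y\<in>K. lin_min (snd z) (slice (fst z)) Y}"

text \<open>At the level \<open>opt z\<close>, the sublevel condition singles out the minimizers in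
  K. Thus the set is a countable union of preimages of closed sets under a Borel map.\<close>

lemma meets_borel:
  assumes "closed K"
  shows "meets K \<in> sets borel"
proof -
  have "meets K = (\<Union>n::nat. (\<lambda>z. (fst z, snd z, opt z)) -` sublevel K (1 / Suc n) \<inter> space borel)"
    by (auto simp: meets_def lin_min_iff_opt slice_iff sublevel_def)
  also have "\<dots> \<in> sets borel"
  proof (intro sets.countable_UN' countableI_type measurable_sets[of _ _ borel] ballI image_subsetI)
    show "(\<lambda>z. (fst z, snd z, opt z)) \<in> borel_measurable borel"
      by (intro borel_measurable_Pair opt_borel borel_measurable_fst_snd)
    show "sublevel K (1 / Suc n) \<in> sets borel" for n
      using closed_sublevel[OF assms] by (rule borel_closed)
  qed
  finally show ?thesis .
qed

section \<open>Objectives with several minimizers\<close>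

definition split_set :: "'a \<Rightarrow> real \<Rightarrow> real \<Rightarrow> ('a \<times> 'a) set" where
  "split_set E p q = meets {Y. E \<bullet> Y \<le> p} \<inter> meets {Y. E \<bullet> Y \<ge> q}"

lemma split_set_borel: "split_set E p q \<in> sets borel"
  unfolding split_set_def
  by (intro sets.Int meets_borel closed_halfspace_le closed_halfspace_ge)

text \<open>Adding the optimality inequalities of a minimizer Y for B and a minimizer Z for
  \<open>B + s E\<close> gives \<open>s (E \<bullet> Z - E \<bullet> Y) \<le> 0\<close>. Choosing Y
  below p and Z above q forces \<open>s \<le> 0\<close>; exchanging the two objectives gives the
  reverse inequality.\<close>

lemma split_set_line:
  assumes pq: "p < q" and z: "(X, B) \<in> split_set E p q" "(X, B + s *\<^sub>R E) \<in> split_set E p q"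
  shows "s = 0"
proof -
  have *: "s \<le> 0" if BS: "(X, B) \<in> split_set E p q" "(X, B + s *\<^sub>R E) \<in> split_set E p q" for B s
  proof -
    obtain Y Z where Y: "lin_min B (slice X) Y" "E \<bullet> Y \<le> p"
      and Z: "lin_min (B + s *\<^sub>R E) (slice X) Z" "E \<bullet> Z \<ge> q"
      using BS by (auto simp: split_set_def meets_def)
    have "B \<bullet> Y \<le> B \<bullet> Z" "(B + s *\<^sub>R E) \<bullet> Z \<le> (B + s *\<^sub>R E) \<bullet> Y"
      using Y Z unfolding lin_min_def by blast+
    hence "s * (E \<bullet> Z - E \<bullet> Y) \<le> 0" by (simp add: inner_add_left algebra_simps)
    moreover have "E \<bullet> Z - E \<bullet> Y > 0" using Y Z pq by simp
    ultimately show ?thesis by (simp add: mult_le_0_iff)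
  qed
  from *[OF z] *[of "B + s *\<^sub>R E" "- s"] z show ?thesis by simp
qed

definition nonunique :: "('a \<times> 'a) set" where
  "nonunique = {z. \<exists>Y Y'. Y \<noteq> Y' \<and> lin_min (snd z) (slice (fst z)) Y \<and> lin_min (snd z) (slice (fst z)) Y'}"

text \<open>Distinct minimizers differ in some direction of D, and two rationals fit between their
  values. D is left open because the standard basis serves for measurability, whereas the null set
  argument takes symmetric directions.\<close>

lemma nonunique_eq:
  assumes sep: "\<And>Y Y'. Y \<in> C \<Longrightarrow> Y' \<in> C \<Longrightarrow> Y \<noteq> Y' \<Longrightarrow> \<exists>E\<in>D. E \<bullet> Y \<noteq> E \<bullet> Y'"
  shows "nonunique = (\<Union>E\<in>D. \<Union>p\<in>\<rat>. \<Union>q\<in>{q\<in>\<rat>. p < q}. split_set E p q)"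
proof (intro set_eqI iffI)
  fix z assume "z \<in> nonunique"
  then obtain Y Y' where Y: "Y \<noteq> Y'" "lin_min (snd z) (slice (fst z)) Y" "lin_min (snd z) (slice (fst z)) Y'"
    by (auto simp: nonunique_def)
  hence "Y \<in> C" "Y' \<in> C" by (auto simp: lin_min_def slice_def base_def)
  then obtain E where E: "E \<in> D" "E \<bullet> Y \<noteq> E \<bullet> Y'" using sep Y(1) by blast
  have *: "z \<in> (\<Union>E\<in>D. \<Union>p\<in>\<rat>. \<Union>q\<in>{q\<in>\<rat>. p < q}. split_set E p q)"
    if lt: "E \<bullet> Y < E \<bullet> Y'" and "lin_min (snd z) (slice (fst z)) Y" "lin_min (snd z) (slice (fst z)) Y'" for Y Y'
  proof -
    obtain p where p: "p \<in> \<rat>" "E \<bullet> Y < p" "p < E \<bullet> Y'" using Rats_dense_in_real[OF lt] by auto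
    obtain q where q: "q \<in> \<rat>" "p < q" "q < E \<bullet> Y'" using Rats_dense_in_real[OF p(3)] by auto
    have "z \<in> split_set E p q"
      using p q that by (auto simp: split_set_def meets_def intro: less_imp_le)
    thus ?thesis using p q E by blast
  qed
  show "z \<in> (\<Union>E\<in>D. \<Union>p\<in>\<rat>. \<Union>q\<in>{q\<in>\<rat>. p < q}. split_set E p q)"
    using *[of Y Y'] *[of Y' Y] Y E(2) by (meson linorder_neqE)
next
  fix z assume "z \<in> (\<Union>E\<in>D. \<Union>p\<in>\<rat>. \<Union>q\<in>{q\<in>\<rat>. p < q}. split_set E p q)"
  then obtain E p q Y Y' where "p < q" "E \<bullet> Y \<le> p" "q \<le> E \<bullet> Y'"
      "lin_min (snd z) (slice (fst z)) Y" "lin_min (snd z) (slice (fst z)) Y'"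
    by (auto simp: split_set_def meets_def)
  moreover from this have "Y \<noteq> Y'" by auto
  ultimately show "z \<in> nonunique" by (auto simp: nonunique_def)
qed

lemma countable_rats_greater: "countable {q \<in> \<rat>. (p::real) < q}"
  using countable_rat by (rule countable_subset[rotated]) auto

lemma nonunique_borel: "nonunique \<in> sets borel"
proof -
  have "nonunique = (\<Union>E\<in>Basis. \<Union>p\<in>\<rat>. \<Union>q\<in>{q\<in>\<rat>. p < q}. split_set E p q)"
    by (rule nonunique_eq) (metis euclidean_eqI inner_commute)
  also have "\<dots> \<in> sets borel"
    by (auto intro!: sets.countable_UN' countable_rats_greater countable_rat countable_finite split_set_borel)
  finally show ?thesis .
qed

section \<open>The unique minimizer and the next iterate as Borel functions\<close>

definition regular :: "('a \<times> 'a) set" where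
  "regular = {z. slice (fst z) \<noteq> {}} - nonunique"

text \<open>On \<open>regular\<close> every exact solver must return this point; elsewhere the value
  0 is a mere default.\<close>

definition pick :: "'a \<times> 'a \<Rightarrow> 'a" where
  "pick z = (if z \<in> regular then THE Y. lin_min (snd z) (slice (fst z)) Y else 0)"

lemma regular_borel: "regular \<in> sets borel"
  unfolding regular_def by (intro sets.Diff slice_nonempty_borel nonunique_borel)

lemma lin_min_regular:
  assumes "(X, B) \<in> regular"
  shows "lin_min B (slice X) Y \<longleftrightarrow> Y = pick (X, B)"
proof -
  have "\<exists>!Y. lin_min B (slice X) Y"
    using assms ex_lin_min[of X B] slice_nonempty_iff[of X] by (auto simp: regular_def nonunique_def)
  moreover from this have "lin_min B (slice X) (THE Y. lin_min B (slice X) Y)" by (rule theI')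
  ultimately show ?thesis using assms unfolding pick_def by auto
qed

lemma pick_borel: "pick \<in> borel_measurable borel"
proof (rule borel_measurableI)
  fix S :: "'a set" assume "open S"
  define K where "K = - S"
  have "closed K" using \<open>open S\<close> by (simp add: K_def closed_Compl)
  \<comment> \<open>Where the minimizer is unique, it lies in K iff some minimizer does; elsewhere
    the default 0 decides.\<close>
  have "pick -` K = (meets K \<inter> regular) \<union> (if 0 \<in> K then - regular else {})"
  proof (intro set_eqI)
    fix z :: "'a \<times> 'a"
    obtain X B where z: "z = (X, B)" by force
    show "z \<in> pick -` K \<longleftrightarrow> z \<in> (meets K \<inter> regular) \<union> (if 0 \<in> K then - regular else {})"
      by (cases "z \<in> regular") (auto simp: z meets_def lin_min_regular, auto simp: pick_def)
  qed
  moreover have "- regular \<in> sets borel" using regular_borel by (rule borel_comp)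
  ultimately have "pick -` K \<in> sets borel"
    using meets_borel[OF \<open>closed K\<close>] regular_borel by auto
  hence "- (pick -` K) \<in> sets borel" by (rule borel_comp)
  also have "- (pick -` K) = pick -` S \<inter> space borel" by (auto simp: K_def)
  finally show "pick -` S \<inter> space borel \<in> sets borel" .
qed

lemma pick_in_slice: "(X, B) \<in> regular \<Longrightarrow> pick (X, B) \<in> slice X"
  using lin_min_regular[of X B "pick (X, B)"] by (simp add: lin_min_def)

definition pick_step :: "'a \<times> 'a \<Rightarrow> real" where
  "pick_step z = (if z \<in> regular then max_step (fst z) (pick z) else 0)"

text \<open>Feasible step lengths form an interval starting at 0, so a positive a is at most the
  maximal step iff the step a itself stays in C. For \<open>a \<le> 0\<close> the superlevel set is
  everything.\<close>

lemma pick_step_borel: "pick_step \<in> borel_measurable borel"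
proof (rule borel_measurableI_ge)
  fix a :: real
  have *: "a \<le> max_step X (pick (X, B)) \<longleftrightarrow> a \<le> 0 \<or> X - a *\<^sub>R pick (X, B) \<in> C"
    if r: "(X, B) \<in> regular" for X B
  proof -
    define M where "M = pick (X, B)"
    have X: "X \<in> C" using r by (auto simp: regular_def slice_nonempty_iff)
    have M: "M \<in> slice X" "\<tau> M = 1" "M \<in> C"
      using pick_in_slice[OF r] by (auto simp: M_def slice_def base_def)
    have mx: "X - max_step X M *\<^sub>R M \<in> C" using max_step_in[OF X M(2)] by (simp add: step_lengths_def)
    have "X - a *\<^sub>R M \<in> C" if "a \<le> max_step X M"
      using convex_cone_diff_scaleR_mono[OF cone M(3) mx that] .
    moreover have "a \<le> max_step X M" if "a \<le> 0" using that max_step_pos[OF X M(1)] by simp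
    moreover have "a \<le> max_step X M" if "X - a *\<^sub>R M \<in> C" "0 < a"
      using that by (intro max_step_ge[OF X M(2)]) (simp add: step_lengths_def)
    ultimately show ?thesis unfolding M_def[symmetric] by force
  qed
  have "{z \<in> space borel. a \<le> pick_step z} =
     (regular \<inter> ((\<lambda>z. fst z - a *\<^sub>R pick z) -` C \<inter> space borel)) \<union> (if a \<le> 0 then UNIV else {})"
    using * by (auto simp: pick_step_def)
  moreover have "(\<lambda>z. fst z - a *\<^sub>R pick z) -` C \<inter> space borel \<in> sets borel"
    using pick_borel closed_C by (intro measurable_sets[of _ _ borel] borel_measurable_diff borel_measurable_scaleR
        borel_measurable_fst_snd) auto
  ultimately show "{z \<in> space borel. a \<le> pick_step z} \<in> sets borel"
    using regular_borel by auto
qed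

definition next_iterate :: "'a \<times> 'a \<Rightarrow> 'a" where
  "next_iterate z = fst z - pick_step z *\<^sub>R pick z"

lemma next_iterate_borel: "next_iterate \<in> borel_measurable borel"
  unfolding next_iterate_def
  by (intro borel_measurable_diff borel_measurable_scaleR pick_borel pick_step_borel borel_measurable_fst_snd)

text \<open>Indices are shifted: position k corresponds to \<open>Xs (k + 1)\<close> in a run. At a
  pair outside \<open>regular\<close> the sequence stays put.\<close>

primrec iterate :: "'a \<Rightarrow> (nat \<Rightarrow> 'a) \<Rightarrow> nat \<Rightarrow> 'a" where
  "iterate X b 0 = X"
| "iterate X b (Suc k) = next_iterate (iterate X b k, b (Suc k))"

text \<open>Position k involves only the draws \<open>B 1\<close> to \<open>B k\<close>, all known
  just before \<open>B (Suc k)\<close> is drawn.\<close>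

lemma iterate_measurable:
  assumes fil: "filtration (space P) G"
    and B: "\<And>k. k \<ge> 1 \<Longrightarrow> B k \<in> borel_measurable (G (Suc k))"
  shows "(\<lambda>\<omega>. iterate X (\<lambda>k. B k \<omega>) k) \<in> borel_measurable (G (Suc k))"
proof (induction k)
  case 0
  show ?case by simp
next
  case (Suc k)
  have "subalgebra (G (Suc (Suc k))) (G (Suc k))"
    using filtration.space_F[OF fil] filtration.sets_F_mono[OF fil] by (simp add: subalgebra_def)
  from measurable_from_subalg[OF this Suc.IH] B[of "Suc k"]
  have "(\<lambda>\<omega>. (iterate X (\<lambda>k. B k \<omega>) k, B (Suc k) \<omega>)) \<in> borel_measurable (G (Suc (Suc k)))"
    by (intro borel_measurable_Pair) auto
  from measurable_compose[OF this next_iterate_borel] show ?case by simp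
qed

end

section \<open>Conditional distributions and null sets of symmetric matrices\<close>

text \<open>Disintegration of the joint law of the information and Z. The definition is the case of
  rectangles, which form an intersection-stable generator; both sides pass to complements, as all
  masses are finite with total 1, and to countable disjoint unions.\<close>

lemma emeasure_regular_cond_distr:
  assumes D: "regular_cond_distr P F Z D" and sub: "subalgebra P F" and P: "prob_space P"
    and Z: "Z \<in> borel_measurable P" and A: "A \<in> sets (F \<Otimes>\<^sub>M borel)"
  shows "emeasure P {\<omega>\<in>space P. (\<omega>, Z \<omega>) \<in> A} = (\<integral>\<^sup>+\<omega>. emeasure (D \<omega>) (Pair \<omega> -` A) \<partial>P)"
proof -
  interpret prob_space P by fact
  have sp: "space F = space P" and FP: "sets F \<subseteq> sets P" using sub by (auto simp: subalgebra_def)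
  have D_meas: "D \<in> measurable F (prob_algebra borel)"
    and D_eq: "\<And>a S. a \<in> sets F \<Longrightarrow> S \<in> sets borel \<Longrightarrow>
      emeasure P (a \<inter> Z -` S) = (\<integral>\<^sup>+\<omega>\<in>a. emeasure (D \<omega>) S \<partial>P)"
    using D by (auto simp: regular_cond_distr_def)
  have D_space: "prob_space (D \<omega>)" "sets (D \<omega>) = sets borel" "space (D \<omega>) = UNIV" if "\<omega> \<in> space P" for \<omega>
    using measurable_space[OF D_meas, of \<omega>] that sp sets_eq_imp_space_eq[of "D \<omega>" borel]
    by (auto simp: space_prob_algebra)
  have kernel_meas: "(\<lambda>\<omega>. emeasure (D \<omega>) (Pair \<omega> -` A)) \<in> borel_measurable P"
    if A: "A \<in> sets (F \<Otimes>\<^sub>M borel)" for A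
  proof (rule measurable_from_subalg[OF sub emeasure_measurable_subprob_algebra2])
    have "A \<subseteq> space F \<times> UNIV" using sets.sets_into_space[OF A] by (simp add: space_pair_measure)
    hence "Sigma (space F) (\<lambda>x. Pair x -` A) = A" by auto
    thus "Sigma (space F) (\<lambda>x. Pair x -` A) \<in> sets (F \<Otimes>\<^sub>M borel)" using A by simp
    show "D \<in> measurable F (subprob_algebra borel)" by (rule measurable_prob_algebraD[OF D_meas])
  qed
  have "(\<lambda>\<omega>. (\<omega>, Z \<omega>)) \<in> measurable P (F \<Otimes>\<^sub>M borel)"
    using Z measurable_from_subalg[OF sub measurable_ident] by (intro measurable_Pair) (auto simp: id_def)
  hence graph_meas: "{\<omega>\<in>space P. (\<omega>, Z \<omega>) \<in> A} \<in> sets P" if "A \<in> sets (F \<Otimes>\<^sub>M borel)" for A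
    using that measurable_sets[of "\<lambda>\<omega>. (\<omega>, Z \<omega>)" P "F \<Otimes>\<^sub>M borel" A]
    by (simp add: vimage_def Int_def conj_commute)
  have section_in: "Pair \<omega> -` A \<in> sets (D \<omega>)" if "\<omega> \<in> space P" "A \<in> sets (F \<Otimes>\<^sub>M borel)" for \<omega> A
    using sets_Pair1[OF that(2)] D_space[OF that(1)] by simp
  let ?G = "{a \<times> b | a b. a \<in> sets F \<and> b \<in> sets (borel :: 'b measure)}"
  let ?\<Omega> = "space F \<times> space (borel :: 'b measure)"
  have sigma: "sigma_sets ?\<Omega> ?G = sets (F \<Otimes>\<^sub>M (borel :: 'b measure))" by (rule sets_pair_measure[symmetric])
  have G: "?G \<subseteq> Pow ?\<Omega>" by (rule pair_measure_closed)
  have "A \<in> sigma_sets ?\<Omega> ?G" using A sigma by simp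
  from Int_stable_pair_measure_generator[of F "borel :: 'b measure"] G this show ?thesis
  proof (induction rule: sigma_sets_induct_disjoint)
    case (basic A)
    then obtain a b where ab: "A = a \<times> b" "a \<in> sets F" "b \<in> sets borel" by blast
    have "a \<subseteq> space P" using sets.sets_into_space[OF ab(2)] sp by simp
    hence "{\<omega>\<in>space P. (\<omega>, Z \<omega>) \<in> A} = a \<inter> Z -` b" using ab by auto
    also have "emeasure P (a \<inter> Z -` b) = (\<integral>\<^sup>+\<omega>\<in>a. emeasure (D \<omega>) b \<partial>P)" using D_eq ab by simp
    also have "\<dots> = (\<integral>\<^sup>+\<omega>. emeasure (D \<omega>) (Pair \<omega> -` A) \<partial>P)"
      by (rule nn_integral_cong) (auto simp: ab indicator_def)
    finally show ?case .
  next
    case empty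
    show ?case by simp
  next
    case (compl A)
    hence A: "A \<in> sets (F \<Otimes>\<^sub>M borel)" using sigma by simp
    have "{\<omega>\<in>space P. (\<omega>, Z \<omega>) \<in> ?\<Omega> - A} = space P - {\<omega>\<in>space P. (\<omega>, Z \<omega>) \<in> A}"
      using sp by auto
    hence "emeasure P {\<omega>\<in>space P. (\<omega>, Z \<omega>) \<in> ?\<Omega> - A} = 1 - emeasure P {\<omega>\<in>space P. (\<omega>, Z \<omega>) \<in> A}"
      using emeasure_compl[OF graph_meas[OF A]] by (simp add: emeasure_space_1)
    also have "\<dots> = (\<integral>\<^sup>+\<omega>. 1 \<partial>P) - (\<integral>\<^sup>+\<omega>. emeasure (D \<omega>) (Pair \<omega> -` A) \<partial>P)"
      using compl.IH by (simp add: emeasure_space_1)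
    also have "\<dots> = (\<integral>\<^sup>+\<omega>. 1 - emeasure (D \<omega>) (Pair \<omega> -` A) \<partial>P)"
    proof (rule nn_integral_diff[symmetric])
      show "(\<lambda>\<omega>. emeasure (D \<omega>) (Pair \<omega> -` A)) \<in> borel_measurable P" by (rule kernel_meas[OF A])
      show "(\<integral>\<^sup>+\<omega>. emeasure (D \<omega>) (Pair \<omega> -` A) \<partial>P) \<noteq> \<infinity>"
        unfolding compl.IH[symmetric] by simp
      show "AE \<omega> in P. emeasure (D \<omega>) (Pair \<omega> -` A) \<le> 1"
        using D_space by (intro AE_I2 prob_space.emeasure_le_1) auto
    qed simp
    also have "\<dots> = (\<integral>\<^sup>+\<omega>. emeasure (D \<omega>) (Pair \<omega> -` (?\<Omega> - A)) \<partial>P)"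
    proof (rule nn_integral_cong)
      fix \<omega> assume w: "\<omega> \<in> space P"
      interpret D: prob_space "D \<omega>" using D_space[OF w] by simp
      have "Pair \<omega> -` (?\<Omega> - A) = space (D \<omega>) - Pair \<omega> -` A" using D_space[OF w] sp w by auto
      thus "1 - emeasure (D \<omega>) (Pair \<omega> -` A) = emeasure (D \<omega>) (Pair \<omega> -` (?\<Omega> - A))"
        using emeasure_compl[OF section_in[OF w A]] by (simp add: D.emeasure_space_1)
    qed
    finally show ?case .
  next
    case (union A)
    hence A: "\<And>i. A i \<in> sets (F \<Otimes>\<^sub>M borel)" using sigma by auto
    have "{\<omega>\<in>space P. (\<omega>, Z \<omega>) \<in> \<Union>(range A)} = (\<Union>i. {\<omega>\<in>space P. (\<omega>, Z \<omega>) \<in> A i})" by auto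
    moreover have "disjoint_family (\<lambda>i. {\<omega>\<in>space P. (\<omega>, Z \<omega>) \<in> A i})"
      using union.hyps(1) by (fastforce simp: disjoint_family_on_def)
    moreover have "range (\<lambda>i. {\<omega>\<in>space P. (\<omega>, Z \<omega>) \<in> A i}) \<subseteq> sets P"
      using graph_meas[OF A] by blast
    ultimately have "emeasure P {\<omega>\<in>space P. (\<omega>, Z \<omega>) \<in> \<Union>(range A)}
        = (\<Sum>i. emeasure P {\<omega>\<in>space P. (\<omega>, Z \<omega>) \<in> A i})"
      by (simp only: suminf_emeasure)
    also have "\<dots> = (\<Sum>i. \<integral>\<^sup>+\<omega>. emeasure (D \<omega>) (Pair \<omega> -` A i) \<partial>P)" using union.IH by simp
    also have "\<dots> = (\<integral>\<^sup>+\<omega>. (\<Sum>i. emeasure (D \<omega>) (Pair \<omega> -` A i)) \<partial>P)"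
      by (rule nn_integral_suminf[symmetric]) (rule kernel_meas[OF A])
    also have "\<dots> = (\<integral>\<^sup>+\<omega>. emeasure (D \<omega>) (Pair \<omega> -` \<Union>(range A)) \<partial>P)"
    proof (rule nn_integral_cong)
      fix \<omega> assume w: "\<omega> \<in> space P"
      have "disjoint_family (\<lambda>i. Pair \<omega> -` A i)"
        using union.hyps(1) by (fastforce simp: disjoint_family_on_def)
      thus "(\<Sum>i. emeasure (D \<omega>) (Pair \<omega> -` A i)) = emeasure (D \<omega>) (Pair \<omega> -` \<Union>(range A))"
        using suminf_emeasure[of "\<lambda>i. Pair \<omega> -` A i" "D \<omega>"] section_in[OF w A]
        by (auto simp: vimage_Union)
    qed
    finally show ?case .
  qed
qed

text \<open>Y is determined by the information in F, so the probability of hitting N is the average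
  of the conditional masses of the sections of N at \<open>Y \<omega>\<close>, each of which is
  0.\<close>

lemma regular_cond_distr_AE_notin:
  fixes Y :: "'w \<Rightarrow> 'b::second_countable_topology" and Z :: "'w \<Rightarrow> 'a::second_countable_topology"
  assumes D: "regular_cond_distr P F Z D" and sub: "subalgebra P F" and P: "prob_space P"
    and Z: "Z \<in> borel_measurable P" and Y: "Y \<in> borel_measurable F" and N: "N \<in> sets borel"
    and null: "\<And>\<omega>. \<omega> \<in> space P \<Longrightarrow> {z. (Y \<omega>, z) \<in> N} \<in> null_sets (D \<omega>)"
  shows "AE \<omega> in P. (Y \<omega>, Z \<omega>) \<notin> N"
proof -
  have sp: "space F = space P" using sub by (simp add: subalgebra_def)
  define A where "A = (\<lambda>(\<omega>, z). (Y \<omega>, z)) -` N \<inter> space (F \<Otimes>\<^sub>M (borel :: 'a measure))"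
  have "(\<lambda>(\<omega>, z). (Y \<omega>, z :: 'a)) \<in> measurable (F \<Otimes>\<^sub>M borel) (borel \<Otimes>\<^sub>M borel)"
    using Y by measurable
  hence A: "A \<in> sets (F \<Otimes>\<^sub>M borel)"
    unfolding A_def using N by (intro measurable_sets) (auto simp: borel_prod)
  have eq: "{\<omega>\<in>space P. (\<omega>, Z \<omega>) \<in> A} = {\<omega>\<in>space P. \<not> (Y \<omega>, Z \<omega>) \<notin> N}"
    by (auto simp: A_def space_pair_measure sp)
  have "(\<lambda>\<omega>. (Y \<omega>, Z \<omega>)) \<in> borel_measurable P"
    using Z measurable_from_subalg[OF sub Y] by (rule borel_measurable_Pair[rotated])
  hence meas: "{\<omega>\<in>space P. \<not> (Y \<omega>, Z \<omega>) \<notin> N} \<in> sets P"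
    using measurable_sets[OF _ N, of "\<lambda>\<omega>. (Y \<omega>, Z \<omega>)" P] by (simp add: vimage_def Int_def conj_commute)
  have "emeasure (D \<omega>) (Pair \<omega> -` A) = 0" if w: "\<omega> \<in> space P" for \<omega>
  proof -
    have "Pair \<omega> -` A = {z. (Y \<omega>, z) \<in> N}" using w sp by (auto simp: A_def space_pair_measure)
    thus ?thesis using null[OF w] by auto
  qed
  hence "(\<integral>\<^sup>+\<omega>. emeasure (D \<omega>) (Pair \<omega> -` A) \<partial>P) = (\<integral>\<^sup>+\<omega>. 0 \<partial>P)" by (intro nn_integral_cong) simp
  hence "emeasure P {\<omega>\<in>space P. \<not> (Y \<omega>, Z \<omega>) \<notin> N} = 0"
    using emeasure_regular_cond_distr[OF D sub P Z A] eq by simp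
  thus ?thesis by (subst AE_iff_measurable[OF meas refl])
qed

section \<open>Coordinate directions and null sets of symmetric matrices\<close>

definition coord_mat :: "'n set \<Rightarrow> real^'n^'n" where
  "coord_mat s = (\<chi> i j. if {i, j} = s then 1 else 0)"

lemma sym_coords_measurable:
  "(\<lambda>x. \<chi> i j. x {i, j}) \<in> measurable (\<Pi>\<^sub>M s\<in>{{i, j} | i j. True}. lborel) (borel :: (real^'n^'n) measure)"
proof (rule borel_measurable_euclidean_space[THEN iffD2], rule ballI)
  fix b :: "real^'n^'n" assume "b \<in> Basis"
  then obtain i j where b: "b = axis i (axis j 1)" by (auto simp: Basis_vec_def)
  have "(\<lambda>x. (\<chi> i j. x {i, j}) \<bullet> b) = (\<lambda>x. x {i, j} :: real)" by (simp add: b inner_axis)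
  moreover have "(\<lambda>x. x {i, j} :: real) \<in> measurable (\<Pi>\<^sub>M s\<in>{{i, j} | i j. True}. lborel) lborel"
    by (rule measurable_component_singleton) auto
  ultimately show "(\<lambda>x. (\<chi> i j. x {i, j}) \<bullet> b) \<in> borel_measurable (\<Pi>\<^sub>M s\<in>{{i, j} | i j. True}. lborel)"
    by (simp only: measurable_lborel1)
qed

text \<open>Integrate first over the coordinate indexed by {i, j}. With the others fixed, it moves
  the matrix along a line that meets N at most once, and a single point has measure 0.\<close>

lemma null_sets_sym_lborel_lines:
  fixes N :: "(real^'n^'n) set"
  assumes N: "N \<in> sets borel"
    and line: "\<And>B t. B \<in> N \<Longrightarrow> B + t *\<^sub>R coord_mat {i, j} \<in> N \<Longrightarrow> t = 0"
  shows "N \<in> null_sets sym_lborel"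
proof -
  interpret product_sigma_finite "\<lambda>_ :: 'n set. lborel :: real measure"
    by (intro product_sigma_finite.intro sigma_finite_lborel)
  define I :: "'n set set" where "I = {{i, j} | i j. True}"
  define s where "s = {i, j}"
  define J where "J = I - {s}"
  define \<phi> where "\<phi> = (\<lambda>x :: 'n set \<Rightarrow> real. \<chi> i j. x {i, j})"
  define Q where "Q = \<phi> -` N \<inter> space (\<Pi>\<^sub>M s\<in>I. lborel :: real measure)"
  have I: "I = insert s J" "finite J" "s \<notin> J" by (auto simp: I_def J_def s_def)
  have Q: "Q \<in> sets (\<Pi>\<^sub>M s\<in>I. lborel)"
    unfolding Q_def \<phi>_def I_def using N by (intro measurable_sets[OF sym_coords_measurable])
  \<comment> \<open>Changing coordinate s alters the entries (i, j) and (j, i) together, which is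
    the direction \<open>coord_mat s\<close>.\<close>
  have shift: "\<phi> (x(s := y')) = \<phi> (x(s := y)) + (y' - y) *\<^sub>R coord_mat s" for x y y'
    by (auto simp: \<phi>_def coord_mat_def vec_eq_iff)
  have inner: "(\<integral>\<^sup>+y. indicator Q (x(s := y)) \<partial>lborel) = 0" for x
  proof -
    have one: "y' = y" if "x(s := y) \<in> Q" "x(s := y') \<in> Q" for y y'
      using line[of "\<phi> (x(s := y))" "y' - y"] that shift[of x y' y] by (auto simp: Q_def s_def)
    obtain y0 where y0: "{y. x(s := y) \<in> Q} \<subseteq> {y0}"
    proof (cases "{y. x(s := y) \<in> Q} = {}")
      case True thus ?thesis using that by blast
    next
      case False
      then obtain y0 where "x(s := y0) \<in> Q" by blast
      thus ?thesis using one that[of y0] by blast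
    qed
    have "(\<integral>\<^sup>+y. indicator Q (x(s := y)) \<partial>lborel) \<le> (\<integral>\<^sup>+y. indicator {y0} y \<partial>lborel)"
      using y0 by (intro nn_integral_mono) (auto simp: indicator_def)
    thus ?thesis by simp
  qed
  have "emeasure (\<Pi>\<^sub>M s\<in>I. lborel) Q = (\<integral>\<^sup>+x. indicator Q x \<partial>(\<Pi>\<^sub>M s\<in>I. lborel))"
    using Q by simp
  also have "\<dots> = (\<integral>\<^sup>+x. (\<integral>\<^sup>+y. indicator Q (x(s := y)) \<partial>lborel) \<partial>(\<Pi>\<^sub>M s\<in>J. lborel))"
    using Q unfolding I(1) by (intro product_nn_integral_insert I borel_measurable_indicator)
  also have "\<dots> = 0" by (simp add: inner)
  finally have "emeasure sym_lborel N = 0"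
    unfolding sym_lborel_def emeasure_distr[OF sym_coords_measurable N] Q_def \<phi>_def I_def .
  thus ?thesis using N by (auto simp: null_sets_def sym_lborel_def)
qed

lemma coord_mat_separates:
  assumes Y: "Y \<in> sym_mats" "Y' \<in> sym_mats" "Y \<noteq> Y'"
  shows "\<exists>E\<in>{coord_mat {i, j} | i j. True}. E \<bullet> Y \<noteq> E \<bullet> Y'"
proof -
  obtain i j where ij: "Y $ i $ j \<noteq> Y' $ i $ j" using Y(3) by (auto simp: vec_eq_iff)
  define E where "E = coord_mat {i, j}"
  \<comment> \<open>The number of ones in E: 1 for i = j and 2 otherwise. Pairing a symmetric matrix
    with E multiplies its (i, j) entry by this positive factor.\<close>
  define c where "c = (\<Sum>a\<in>UNIV. \<Sum>b\<in>UNIV. E $ a $ b)"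
  have E: "E \<bullet> W = c * W $ i $ j" if "W \<in> sym_mats" for W
  proof -
    have "W $ b $ a = W $ a $ b" for a b
      using that by (simp add: sym_mats_def transpose_def vec_eq_iff)
    hence "E $ a $ b * W $ a $ b = E $ a $ b * W $ i $ j" for a b
      by (auto simp: E_def coord_mat_def doubleton_eq_iff)
    hence "(\<Sum>a\<in>UNIV. \<Sum>b\<in>UNIV. E $ a $ b * W $ a $ b) = (\<Sum>a\<in>UNIV. \<Sum>b\<in>UNIV. E $ a $ b * W $ i $ j)"
      by (intro sum.cong refl)
    thus ?thesis by (simp add: inner_vec_def c_def sum_distrib_right)
  qed
  have nn: "E $ a $ b \<ge> 0" for a b by (simp add: E_def coord_mat_def)
  have "0 < (\<Sum>b\<in>UNIV. E $ i $ b)"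
    by (rule sum_pos2[of _ j]) (use nn in \<open>auto simp: E_def coord_mat_def\<close>)
  hence "0 < c"
    unfolding c_def by (intro sum_pos2[of UNIV i "\<lambda>a. \<Sum>b\<in>UNIV. E $ a $ b"] sum_nonneg nn) auto
  hence "E \<bullet> Y \<noteq> E \<bullet> Y'" using E[OF Y(1)] E[OF Y(2)] ij by simp
  thus ?thesis unfolding E_def by blast
qed

section \<open>Spectrahedral cones as cones with compact base\<close>

lemma psd_entry_le_trace:
  assumes A: "A \<in> psd_cone"
  shows "\<bar>A $ i $ j\<bar> \<le> trace A"
proof -
  have sym: "A $ b $ a = A $ a $ b" for a b
    using A by (simp add: psd_cone_def sym_mats_def transpose_def vec_eq_iff)
  have pos: "0 \<le> v \<bullet> (A *v v)" for v using A by (simp add: psd_cone_def)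
  have entry: "axis a 1 \<bullet> (A *v axis b 1) = A $ a $ b" for a b
    by (simp add: matrix_vector_mult_basis inner_axis' column_def)
  have diag: "0 \<le> A $ a $ a" for a using pos[of "axis a 1"] by (simp add: entry)
  have diag_le: "A $ a $ a \<le> trace A" for a
    unfolding trace_def using diag by (intro member_le_sum) auto
  \<comment> \<open>The sum and the difference of two unit vectors as test vectors bound
    \<open>2 \<bar>A $ i $ j\<bar>\<close> by the two diagonal entries, each at most the
    trace.\<close>
  have "0 \<le> A $ i $ i + 2 * A $ i $ j + A $ j $ j"
    using pos[of "axis i 1 + axis j 1"] sym[of i j]
    by (simp add: entry matrix_vector_right_distrib inner_add_left inner_add_right)
  moreover have "0 \<le> A $ i $ i - 2 * A $ i $ j + A $ j $ j"
    using pos[of "axis i 1 - axis j 1"] sym[of i j]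
    by (simp add: entry matrix_vector_mult_diff_distrib inner_diff_left inner_diff_right)
  ultimately show ?thesis using diag_le[of i] diag_le[of j] by linarith
qed

lemma closed_psd_cone: "closed (psd_cone :: (real^'n^'n) set)"
proof -
  have "closed {A :: real^'n^'n. \<forall>i j. A $ j $ i = A $ i $ j}"
    by (intro closed_Collect_all closed_Collect_eq continuous_intros)
  moreover have "closed {A :: real^'n^'n. \<forall>v. 0 \<le> v \<bullet> (A *v v)}"
    unfolding inner_vec_def matrix_vector_mult_def
    by (intro closed_Collect_all closed_Collect_le) (auto intro!: continuous_intros)
  moreover have eq: "psd_cone = {A :: real^'n^'n. \<forall>i j. A $ j $ i = A $ i $ j} \<inter> {A. \<forall>v. 0 \<le> v \<bullet> (A *v v)}"
    by (auto simp: psd_cone_def sym_mats_def transpose_def vec_eq_iff)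
  ultimately show ?thesis unfolding eq by (intro closed_Int)
qed

lemma spectrahedral_cone_subset:
  assumes "spectrahedral_cone C"
  shows "C \<subseteq> psd_cone" "C \<subseteq> sym_mats"
  using assms by (auto simp: spectrahedral_cone_def psd_cone_def)

lemma based_cone_spectrahedral:
  fixes C :: "(real^'n^'n) set"
  assumes "spectrahedral_cone C"
  shows "based_cone C trace (real (CARD('n) * CARD('n)))"
proof (rule based_cone.intro)
  obtain L where L: "subspace L" "L \<subseteq> sym_mats" "C = L \<inter> psd_cone"
    using assms by (auto simp: spectrahedral_cone_def)
  show "convex_cone C"
    unfolding convex_cone_iff L(3) using L(1,2)
    by (auto simp: subspace_0 subspace_add subspace_mul psd_cone_def matrix_vector_mult_add_rdistrib
        inner_add_right scaleR_matrix_vector_assoc[symmetric] subset_eq)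
  show "closed C" unfolding L(3) using closed_subspace[OF L(1)] closed_psd_cone by (rule closed_Int)
  show "linear (trace :: real^'n^'n \<Rightarrow> real)"
    by (rule linearI) (simp_all add: trace_def sum.distrib sum_distrib_left)
  show "0 < real (CARD('n) * CARD('n))" by simp
  fix A assume "A \<in> C"
  hence A: "A \<in> psd_cone" using L by simp
  \<comment> \<open>The constant counts the entries: the norm is at most the sum of their absolute
    values, each bounded by the trace.\<close>
  have "norm A \<le> (\<Sum>i\<in>UNIV. norm (A $ i))" by (simp add: norm_vec_def L2_set_le_sum)
  also have "\<dots> \<le> (\<Sum>i\<in>UNIV. \<Sum>j\<in>UNIV. \<bar>A $ i $ j\<bar>)" by (intro sum_mono norm_le_l1_cart)
  also have "\<dots> \<le> (\<Sum>i\<in>(UNIV :: 'n set). \<Sum>j\<in>(UNIV :: 'n set). trace A)"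
    by (intro sum_mono psd_entry_le_trace A)
  finally show "norm A \<le> real (CARD('n) * CARD('n)) * trace A" by simp
qed

lemma trace_mult_sym_mats: "Y \<in> sym_mats \<Longrightarrow> trace (B ** Y) = B \<bullet> Y"
  by (auto simp: trace_def matrix_matrix_mult_def inner_vec_def sym_mats_def transpose_def vec_eq_iff
      intro!: sum.cong)

lemma lp_solution_iff_lin_min:
  assumes "F \<subseteq> sym_mats"
  shows "lp_solution B F M \<longleftrightarrow> lin_min B {Y \<in> F. trace Y = 1} M"
  using assms by (auto simp: lp_solution_def is_arg_min_def lin_min_def trace_mult_sym_mats subset_eq not_less)

section \<open>Runs of the algorithm\<close>

text \<open>A countable union over finitely many directions and rational thresholds. The directions
  \<open>coord_mat\<close> are parallel to the coordinates of \<open>sym_lborel\<close> and still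
  separate the points of C, which are symmetric.\<close>

lemma nonunique_section_null:
  assumes C: "spectrahedral_cone C" and cone: "based_cone C trace \<kappa>"
  shows "{B. (X, B) \<in> based_cone.nonunique C trace} \<in> null_sets sym_lborel"
proof -
  interpret based_cone C trace \<kappa> by fact
  let ?D = "{coord_mat {i, j} | i j. True}"
  have "?D \<subseteq> (\<lambda>(i, j). coord_mat {i, j}) ` UNIV" by auto
  hence fin: "finite ?D" by (rule finite_subset) (rule finite_imageI[OF finite])
  have eq: "nonunique = (\<Union>E\<in>?D. \<Union>p\<in>\<rat>. \<Union>q\<in>{q\<in>\<rat>. p < q}. split_set E p q)"
    using spectrahedral_cone_subset(2)[OF C] by (intro nonunique_eq coord_mat_separates) auto
  have null: "{B. (X, B) \<in> split_set E p q} \<in> null_sets sym_lborel" if E: "E \<in> ?D" and pq: "p < q" for E p q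
  proof -
    obtain i j where ij: "E = coord_mat {i, j}" using E by blast
    have "(\<lambda>B. (X, B)) -` split_set E p q \<inter> space borel \<in> sets borel"
      by (rule measurable_sets[OF _ split_set_borel]) (intro borel_measurable_Pair, auto)
    hence "{B. (X, B) \<in> split_set E p q} \<in> sets borel" by (simp add: vimage_def)
    thus ?thesis
      by (rule null_sets_sym_lborel_lines[of _ i j]) (use split_set_line[OF pq] ij in blast)
  qed
  have "{B. (X, B) \<in> nonunique} =
      (\<Union>E\<in>?D. \<Union>p\<in>\<rat>. \<Union>q\<in>{q\<in>\<rat>. p < q}. {B. (X, B) \<in> split_set E p q})"
    unfolding eq by blast
  also have "\<dots> \<in> null_sets sym_lborel"
    by (intro null_sets_UN' countable_finite[OF fin] countable_rat countable_rats_greater null) auto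
  finally show ?thesis .
qed

lemma erd_run_sum:
  assumes "erd_run C X b n Xs Ms ts" "m \<le> n"
  shows "X = (\<Sum>k=1..m. ts k *\<^sub>R Ms k) + Xs (Suc m)"
  using assms(2)
proof (induction m)
  case 0
  thus ?case using assms(1) by (simp add: erd_run_def)
next
  case (Suc m)
  have "Xs (Suc (Suc m)) = Xs (Suc m) - ts (Suc m) *\<^sub>R Ms (Suc m)"
    using assms(1) Suc.prems by (simp add: erd_run_def)
  thus ?case using Suc by simp
qed

context
  fixes C :: "(real^'n^'n) set" and \<kappa> :: real
  assumes C: "spectrahedral_cone C" and based: "based_cone C trace \<kappa>"
begin

interpretation based_cone C trace \<kappa> by (rule based)

lemma lp_solution_minface_iff:
  assumes "X \<in> C"
  shows "lp_solution B (minface X C) M \<longleftrightarrow> lin_min B (slice X) M"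
proof -
  have "minface X C \<subseteq> sym_mats"
    using spectrahedral_cone_subset(2)[OF C] assms by (auto simp: minface_eq)
  thus ?thesis by (simp add: lp_solution_iff_lin_min slice_eq assms)
qed

lemma erd_step_well_defined_nonzero:
  assumes X: "X \<in> C" "X \<noteq> 0"
  shows "erd_step_well_defined C B X"
proof -
  have "step_lengths (minface X C) X M \<noteq> {} \<and> bdd_above (step_lengths (minface X C) X M)"
    if "lin_min B (slice X) M" for M
  proof -
    have M: "M \<in> minface X C" "trace M = 1" using that X by (auto simp: lin_min_def slice_eq)
    show ?thesis
      using step_lengths_bounds(1)[OF X(1) M(2)] bdd_above_step_lengths[OF X(1) M(2)]
      by (auto simp: step_lengths_minface[OF X(1) M(1)])
  qed
  thus ?thesis
    using X ex_lin_min[OF X] face_of_minface[OF convex_C X(1)]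
    by (auto simp: erd_step_well_defined_def lp_solution_minface_iff)
qed

lemma erd_run_step:
  assumes run: "erd_run C X b n Xs Ms ts" and k: "k \<in> {1..n}" and Xk: "Xs k \<in> C"
  shows "lin_min (b k) (slice (Xs k)) (Ms k)" "Ms k \<in> slice (Xs k)" "ts k = max_step (Xs k) (Ms k)"
    "Xs (Suc k) = Xs k - max_step (Xs k) (Ms k) *\<^sub>R Ms k"
proof -
  have lp: "lp_solution (b k) (minface (Xs k) C) (Ms k)"
    and ts: "ts k = Sup (step_lengths (minface (Xs k) C) (Xs k) (Ms k))"
    and nx: "Xs (Suc k) = Xs k - ts k *\<^sub>R Ms k"
    using run k by (auto simp: erd_run_def)
  show lm: "lin_min (b k) (slice (Xs k)) (Ms k)" using lp lp_solution_minface_iff[OF Xk] by simp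
  thus sl: "Ms k \<in> slice (Xs k)" by (simp add: lin_min_def)
  hence "Ms k \<in> minface (Xs k) C" by (simp add: slice_eq Xk)
  thus "ts k = max_step (Xs k) (Ms k)" using ts by (simp add: max_step_def step_lengths_minface Xk)
  thus "Xs (Suc k) = Xs k - max_step (Xs k) (Ms k) *\<^sub>R Ms k" using nx by simp
qed

lemma erd_run_in_cone:
  assumes run: "erd_run C X b n Xs Ms ts" and X: "X \<in> C" and m: "m \<le> n"
  shows "Xs (Suc m) \<in> C"
  using m
proof (induction m)
  case 0
  thus ?case using run X by (simp add: erd_run_def)
next
  case (Suc m)
  hence Xm: "Xs (Suc m) \<in> C" and k: "Suc m \<in> {1..n}" by auto
  show ?case
    unfolding erd_run_step(4)[OF run k Xm] by (rule next_in_C[OF Xm erd_run_step(2)[OF run k Xm]])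
qed

lemma erd_run_aff_dim:
  assumes run: "erd_run C X b n Xs Ms ts" and X: "X \<in> C" and m: "m \<le> n"
  shows "aff_dim (minface (Xs (Suc m)) C) + int m \<le> aff_dim (minface X C)"
  using m
proof (induction m)
  case 0
  thus ?case using run by (simp add: erd_run_def)
next
  case (Suc m)
  hence Xm: "Xs (Suc m) \<in> C" and k: "Suc m \<in> {1..n}" using erd_run_in_cone[OF run X] by auto
  have "aff_dim (minface (Xs (Suc (Suc m))) C) < aff_dim (minface (Xs (Suc m)) C)"
    unfolding erd_run_step(4)[OF run k Xm] by (rule aff_dim_next[OF Xm erd_run_step(2)[OF run k Xm]])
  thus ?case using Suc by simp
qed

text \<open>Every iteration costs at least one dimension, and an affine dimension is at least
  -1.\<close>

lemma erd_run_length_le: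
  assumes "erd_run C X b n Xs Ms ts" "X \<in> C"
  shows "int n \<le> aff_dim (minface X C) + 1"
  using erd_run_aff_dim[OF assms, of n] aff_dim_geq[of "minface (Xs (Suc n)) C"] by simp

text \<open>Where minimizers are unique, the solver has no freedom and every run follows
  \<open>iterate\<close>. Uniqueness is imposed along \<open>iterate\<close> because its
  measurability is available, while a run may depend on arbitrary selections.\<close>

lemma erd_run_iterate:
  assumes run: "erd_run C X b n Xs Ms ts" and X: "X \<in> C"
    and uniq: "\<And>k. (iterate X b k, b (Suc k)) \<notin> nonunique" and m: "m \<le> n"
  shows "Xs (Suc m) = iterate X b m"
  using m
proof (induction m)
  case 0
  thus ?case using run by (simp add: erd_run_def)
next
  case (Suc m)
  hence k: "Suc m \<in> {1..n}" and IH: "Xs (Suc m) = iterate X b m" by auto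
  have Xm: "Xs (Suc m) \<in> C" using erd_run_in_cone[OF run X, of m] Suc.prems by simp
  note step = erd_run_step[OF run k Xm]
  have reg: "(Xs (Suc m), b (Suc m)) \<in> regular"
    using uniq[of m] step(2) by (auto simp: regular_def IH)
  hence "Ms (Suc m) = pick (Xs (Suc m), b (Suc m))" using lin_min_regular step(1) by blast
  thus ?case using step(4) reg by (simp add: next_iterate_def pick_step_def IH[symmetric])
qed

text \<open>Uniqueness carries over from \<open>iterate\<close> to the run, so each
  \<open>Ms k\<close> spans an extreme ray. The sum telescopes to X once the last iterate
  vanishes.\<close>

lemma erd_run_extreme_ray_decomposition:
  assumes run: "erd_run C X b n Xs Ms ts" and X: "X \<in> C"
    and uniq: "\<And>k. (iterate X b k, b (Suc k)) \<notin> nonunique" and stop: "Xs (Suc n) = 0"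
  shows "extreme_ray_decomposition C X n ts Ms"
proof -
  have "0 < ts k \<and> spans_extreme_ray (Ms k) C" if k: "k \<in> {1..n}" for k
  proof -
    obtain m where m: "k = Suc m" "m \<le> n" using k by (cases k) auto
    have Xk: "Xs k \<in> C" using erd_run_in_cone[OF run X m(2)] m by simp
    note step = erd_run_step[OF run k Xk]
    have "(Xs k, b k) \<notin> nonunique" using uniq[of m] erd_run_iterate[OF run X uniq m(2)] m by simp
    hence "M' = Ms k" if "lin_min (b k) (slice (Xs k)) M'" for M'
      using that step(1) by (auto simp: nonunique_def)
    hence "spans_extreme_ray (Ms k) C" by (rule unique_lin_min_extreme_ray[OF Xk step(1)])
    thus ?thesis using max_step_pos[OF Xk step(2)] step(3) by simp
  qed
  thus ?thesis
    using erd_run_sum[OF run order_refl] stop by (simp add: extreme_ray_decomposition_def)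
qed

text \<open>Given \<open>G (Suc k)\<close> the current iterate is fixed, and its bad objectives form
  a null set for \<open>sym_lborel\<close>, hence for the conditional distribution of the draw.
  There are countably many k.\<close>

lemma AE_iterate_unique:
  assumes "random_objectives P G B"
  shows "AE \<omega> in P. \<forall>k. (iterate X (\<lambda>k. B k \<omega>) k, B (Suc k) \<omega>) \<notin> nonunique"
  unfolding AE_all_countable
proof
  fix k
  have P: "prob_space P" and fil: "filtration (space P) G"
    and sub: "\<And>k. k \<ge> 1 \<Longrightarrow> subalgebra P (G k)"
    and B: "\<And>k. k \<ge> 1 \<Longrightarrow> B k \<in> borel_measurable (G (Suc k))"
    using assms by (auto simp: random_objectives_def)
  have "\<exists>D. regular_cond_distr P (G (Suc k)) (B (Suc k)) D \<and>
      (\<forall>\<omega>\<in>space P. absolutely_continuous sym_lborel (D \<omega>))"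
    using assms by (simp add: random_objectives_def)
  then obtain D where D: "regular_cond_distr P (G (Suc k)) (B (Suc k)) D"
    and ac: "\<And>\<omega>. \<omega> \<in> space P \<Longrightarrow> absolutely_continuous sym_lborel (D \<omega>)"
    by blast
  have "subalgebra P (G (Suc k))" "B (Suc k) \<in> borel_measurable P"
    using sub measurable_from_subalg[OF sub B] by auto
  thus "AE \<omega> in P. (iterate X (\<lambda>k. B k \<omega>) k, B (Suc k) \<omega>) \<notin> nonunique"
    using nonunique_section_null[OF C based] ac
    by (intro regular_cond_distr_AE_notin[OF D _ P] iterate_measurable[OF fil B] nonunique_borel)
      (auto simp: absolutely_continuous_def)
qed

end

section \<open>Well-definedness, termination and almost sure extreme ray decomposition\<close>

theorem theorem3:
  fixes C :: "(real^'n^'n) set" and X :: "real^'n^'n"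
    and P :: "'w measure" and G :: "nat \<Rightarrow> 'w measure" and B :: "nat \<Rightarrow> 'w \<Rightarrow> real^'n^'n"
  assumes "spectrahedral_cone C" and "C \<noteq> {}" and "X \<in> C" and "X \<noteq> 0"
    and "random_objectives P G B"
  shows "(\<forall>b n Xs Ms ts. (\<forall>k. b k \<in> sym_mats) \<and> erd_run C X b n Xs Ms ts \<and> Xs (n + 1) \<noteq> 0
            \<longrightarrow> erd_step_well_defined C (b (n + 1)) (Xs (n + 1)))
       \<and> \<not> (\<exists>b Xs Ms ts. (\<forall>k. b k \<in> sym_mats) \<and> (\<forall>n. erd_run C X b n Xs Ms ts))
       \<and> (AE \<omega> in P. \<forall>r Xs Ms ts. erd_run C X (\<lambda>k. B k \<omega>) r Xs Ms ts \<and> Xs (r + 1) = 0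
            \<longrightarrow> extreme_ray_decomposition C X r ts Ms)"
proof (intro conjI)
  note cone = assms(1) based_cone_spectrahedral[OF assms(1)]
  show "\<forall>b n Xs Ms ts. (\<forall>k. b k \<in> sym_mats) \<and> erd_run C X b n Xs Ms ts \<and> Xs (n + 1) \<noteq> 0
            \<longrightarrow> erd_step_well_defined C (b (n + 1)) (Xs (n + 1))"
    using erd_step_well_defined_nonzero[OF cone] erd_run_in_cone[OF cone _ assms(3) order_refl]
    by (metis Suc_eq_plus1)
  show "\<not> (\<exists>b Xs Ms ts. (\<forall>k. b k \<in> sym_mats) \<and> (\<forall>n. erd_run C X b n Xs Ms ts))"
  proof
    assume "\<exists>b Xs Ms ts. (\<forall>k. b k \<in> sym_mats) \<and> (\<forall>n. erd_run C X b n Xs Ms ts)"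
    then obtain b Xs Ms ts where "\<And>n. erd_run C X b n Xs Ms ts" by blast
    hence "int n \<le> aff_dim (minface X C) + 1" for n by (rule erd_run_length_le[OF cone _ assms(3)])
    \<comment> \<open>One iteration more than the dimension bound allows.\<close>
    from this[of "nat (aff_dim (minface X C) + 2)"] show False by linarith
  qed
  show "AE \<omega> in P. \<forall>r Xs Ms ts. erd_run C X (\<lambda>k. B k \<omega>) r Xs Ms ts \<and> Xs (r + 1) = 0
            \<longrightarrow> extreme_ray_decomposition C X r ts Ms"
    \<comment> \<open>The exceptional event involves only \<open>iterate\<close>, so one null set
      covers all selections of minimizers and all lengths r.\<close>
    using AE_iterate_unique[OF cone assms(5), of X]
    by eventually_elim (auto intro: erd_run_extreme_ray_decomposition[OF cone _ assms(3)])
qed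

end
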